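(* Let $\mu$ be a Borel measure on $\mathbb{R}$ with finite moments of all orders, and let $M=M^{(\mu)}$ be its moment matrix. Then there are weights $w=\{w_i\}_{i\in\mathbb{N}_0}$ such that the quadratic form $Q_M$ with domain $\mathcal{D}$ is closable in $\ell^2(w)$.
   Context: $M^{(\mu)}_{i,j}=\int_{\mathbb{R}}x^{i+j}\,\mathrm{d}\mu(x)$, $i,j\in\mathbb{N}_0$. $\mathcal{D}$ is the space of complex sequences indexed by $\mathbb{N}_0$ with only finitely many nonzero entries. For $c\in\mathcal{D}$, $Q_M(c)=\sum_i\sum_j\overline{c_i}M_{i,j}c_j$. Weights are numbers $w_i>0$, and $\ell^2(w)=\{c:\sum_iw_i|c_i|^2<\infty\}$ with norm $\|c\|^2_{\ell^2(w)}=\sum_iw_i|c_i|^2$. A quadratic form $Q$ on $\mathcal{D}$, dense in a Hilbert space $\mathcal{H}$, is closable (in $\mathcal{H}$) if for every sequence $\{c_n\}\subset\mathcal{D}$, the conditions $c_n\to0$ in $\mathcal{H}$ and $Q(c_n-c_m)\to0$ as $m,n\to\infty$ imply $Q(c_n)\to0$ as $n\to\infty$. *)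

theory Defs
  imports "HOL-Analysis.Analysis"
begin

definition fin_seqs :: "(nat \<Rightarrow> complex) set" where
  "fin_seqs = {c. finite {i. c i \<noteq> 0}}"

definition has_all_moments :: "real measure \<Rightarrow> bool" where
  "has_all_moments \<mu> \<longleftrightarrow> (\<forall>k::nat. integrable \<mu> (\<lambda>x. x ^ k))"

definition moment_matrix :: "real measure \<Rightarrow> nat \<Rightarrow> nat \<Rightarrow> complex" where
  "moment_matrix \<mu> i j = complex_of_real (integral\<^sup>L \<mu> (\<lambda>x. x ^ (i + j)))"

text \<open>For sequences in \<^const>\<open>fin_seqs\<close> both series below have only finitely many nonzero terms.\<close>

definition matrix_form :: "(nat \<Rightarrow> nat \<Rightarrow> complex) \<Rightarrow> (nat \<Rightarrow> complex) \<Rightarrow> complex" where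
  "matrix_form M c = (\<Sum>i. \<Sum>j. cnj (c i) * M i j * c j)"

definition weights :: "(nat \<Rightarrow> real) \<Rightarrow> bool" where
  "weights w \<longleftrightarrow> (\<forall>i. w i > 0)"

definition ell2 :: "(nat \<Rightarrow> real) \<Rightarrow> (nat \<Rightarrow> complex) set" where
  "ell2 w = {c. summable (\<lambda>i. w i * (cmod (c i))\<^sup>2)}"

definition ell2_norm :: "(nat \<Rightarrow> real) \<Rightarrow> (nat \<Rightarrow> complex) \<Rightarrow> real" where
  "ell2_norm w c = sqrt (\<Sum>i. w i * (cmod (c i))\<^sup>2)"

text \<open>The next definition is closability, in the weighted space \<^term>\<open>ell2 w\<close>, of a quadratic form
  with domain \<^const>\<open>fin_seqs\<close>. For positive weights this domain is a dense subset of
  \<^term>\<open>ell2 w\<close>: see \<open>fin_seqs_subset_ell2\<close> and \<open>fin_seqs_dense_ell2\<close>.\<close>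

definition closable_in_ell2 ::
    "(nat \<Rightarrow> real) \<Rightarrow> ((nat \<Rightarrow> complex) \<Rightarrow> complex) \<Rightarrow> bool" where
  "closable_in_ell2 w Q \<longleftrightarrow>
     (\<forall>c :: nat \<Rightarrow> nat \<Rightarrow> complex.
        (\<forall>n. c n \<in> fin_seqs) \<longrightarrow>
        (\<lambda>n. ell2_norm w (c n)) \<longlonglongrightarrow> 0 \<longrightarrow>
        ((\<lambda>(m, n). Q (\<lambda>i. c n i - c m i)) \<longlongrightarrow> 0) (sequentially \<times>\<^sub>F sequentially) \<longrightarrow>
        (\<lambda>n. Q (c n)) \<longlonglongrightarrow> 0)"

lemma fin_seqs_subset_ell2: "fin_seqs \<subseteq> ell2 w"
proof
  fix c assume "c \<in> fin_seqs"
  then have "finite {i. c i \<noteq> 0}" by (simp add: fin_seqs_def)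
  then show "c \<in> ell2 w"
    unfolding ell2_def mem_Collect_eq by (rule summable_finite) simp
qed

lemma fin_seqs_dense_ell2:
  assumes "weights w" and "c \<in> ell2 w" and "e > 0"
  shows "\<exists>d\<in>fin_seqs. ell2_norm w (\<lambda>i. c i - d i) < e"
proof -
  let ?f = "\<lambda>i. w i * (cmod (c i))\<^sup>2"
  have s: "summable ?f" using assms(2) by (simp add: ell2_def)
  obtain N where N: "norm (\<Sum>i. ?f (i + N)) < e\<^sup>2"
    using suminf_exist_split[OF _ s, of "e\<^sup>2"] assms(3) by auto
  define d where "d = (\<lambda>i. if i < N then c i else 0)"
  have "finite {i. d i \<noteq> 0}"
    by (rule finite_subset[of _ "{..<N}"]) (auto simp: d_def)
  then have d: "d \<in> fin_seqs" by (simp add: fin_seqs_def)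
  let ?g = "\<lambda>i. w i * (cmod (c i - d i))\<^sup>2"
  have "summable (\<lambda>i. ?g (i + N))"
    using summable_ignore_initial_segment[OF s, of N] by (simp add: d_def)
  then have sg: "summable ?g" using summable_iff_shift[of ?g N] by blast
  have "suminf ?g = (\<Sum>i. ?g (i + N)) + sum ?g {..<N}"
    by (rule suminf_split_initial_segment[OF sg])
  also have "\<dots> = (\<Sum>i. ?f (i + N))" by (simp add: d_def)
  also have "\<dots> < e\<^sup>2" using N by (simp add: abs_less_iff)
  finally have "ell2_norm w (\<lambda>i. c i - d i) < e"
    unfolding ell2_norm_def using assms(3) by (simp add: real_less_lsqrt)
  with d show ?thesis by blast
qed

end

theory Submission
  imports Defs
begin

text \<open>The form is $Q_M(c) = \int |p_c|^2 \, d\mu$ with $p_c(x) = \sum_i c_i x^i$. For the weights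
  $w_i = i!$, Cauchy-Schwarz gives $|p_c(x)|^2 \leq e^{x^2} \|c\|^2_{\ell^2(w)}$, so convergence in
  $\ell^2(w)$ forces pointwise convergence of the polynomials everywhere. If moreover
  $p_{c_n}$ is Cauchy in $L^2(\mu)$, Fatou's lemma applied to $p_{c_n} - p_{c_m}$ as
  $m \to \infty$ shows that the $L^2$ limit is $0$ as well.\<close>

text \<open>Written as a series so that no degree bound has to accompany \<open>c\<close>; on
  \<open>fin_seqs\<close> it is a polynomial evaluated at a real point.\<close>

definition coeff_poly :: "(nat \<Rightarrow> complex) \<Rightarrow> real \<Rightarrow> complex" where
  "coeff_poly c x = (\<Sum>i. c i * complex_of_real x ^ i)"

lemma fin_seqs_bounded_support:
  assumes "c \<in> fin_seqs"
  obtains N where "\<And>i. i \<ge> N \<Longrightarrow> c i = 0"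
proof -
  have "finite {i. c i \<noteq> 0}" using assms by (simp add: fin_seqs_def)
  then obtain N where "\<forall>i\<in>{i. c i \<noteq> 0}. i < N"
    using finite_nat_set_iff_bounded by blast
  then show ?thesis using that[of N] by (meson linorder_not_le mem_Collect_eq)
qed

lemma fin_seqs_diff:
  assumes "c \<in> fin_seqs" "d \<in> fin_seqs"
  shows "(\<lambda>i. c i - d i) \<in> fin_seqs"
proof -
  have "finite ({i. c i \<noteq> 0} \<union> {i. d i \<noteq> 0})"
    using assms by (simp add: fin_seqs_def)
  then show ?thesis
    unfolding fin_seqs_def mem_Collect_eq by (rule rev_finite_subset) auto
qed

lemma coeff_poly_eq_sum:
  assumes "\<And>i. i \<ge> N \<Longrightarrow> c i = 0"
  shows "coeff_poly c x = (\<Sum>i<N. c i * complex_of_real x ^ i)"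
  unfolding coeff_poly_def by (rule suminf_finite) (auto simp: assms)

lemma summable_coeff_poly:
  assumes "c \<in> fin_seqs"
  shows "summable (\<lambda>i. c i * complex_of_real x ^ i)"
  using assms by (intro summable_finite[of "{i. c i \<noteq> 0}"]) (auto simp: fin_seqs_def)

lemma coeff_poly_diff:
  assumes "c \<in> fin_seqs" "d \<in> fin_seqs"
  shows "coeff_poly (\<lambda>i. c i - d i) x = coeff_poly c x - coeff_poly d x"
  unfolding coeff_poly_def left_diff_distrib
  by (rule suminf_diff[symmetric]) (intro summable_coeff_poly assms)+

lemma matrix_form_eq_sum:
  assumes "\<And>i. i \<ge> N \<Longrightarrow> c i = 0"
  shows "matrix_form M c = (\<Sum>i<N. \<Sum>j<N. cnj (c i) * M i j * c j)"
proof -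
  have "(\<Sum>j. cnj (c i) * M i j * c j) = (\<Sum>j<N. cnj (c i) * M i j * c j)" for i
    by (rule suminf_finite) (auto simp: assms)
  moreover have "(\<Sum>i. \<Sum>j<N. cnj (c i) * M i j * c j) = (\<Sum>i<N. \<Sum>j<N. cnj (c i) * M i j * c j)"
    by (rule suminf_finite) (auto simp: assms)
  ultimately show ?thesis by (simp add: matrix_form_def)
qed

text \<open>Expand the squared modulus as \<open>cnj p * p\<close> and integrate the finite double
  sum term by term. Since \<open>x\<close> is real, conjugation only affects the coefficients, and
  the two powers merge into \<open>x ^ (i + j)\<close>, whose integral is the moment.
  \<open>has_bochner_integral\<close> delivers integrability and the value together.\<close>

lemma moment_form_has_integral:
  assumes "has_all_moments \<mu>" and "c \<in> fin_seqs"
  shows "has_bochner_integral \<mu> (\<lambda>x. complex_of_real ((cmod (coeff_poly c x))\<^sup>2))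
           (matrix_form (moment_matrix \<mu>) c)"
proof -
  obtain N where N: "\<And>i. i \<ge> N \<Longrightarrow> c i = 0"
    using fin_seqs_bounded_support[OF assms(2)] by blast
  have form: "matrix_form M c = (\<Sum>i<N. \<Sum>j<N. cnj (c i) * M i j * c j)" for M
    using N by (rule matrix_form_eq_sum)
  have moment: "has_bochner_integral \<mu> (\<lambda>x. complex_of_real (x ^ k))
      (complex_of_real (integral\<^sup>L \<mu> (\<lambda>x. x ^ k)))" for k
    using assms(1) unfolding has_all_moments_def
    by (intro has_bochner_integral_of_real has_bochner_integral_integrable) auto
  have "complex_of_real ((cmod (coeff_poly c x))\<^sup>2) =
      (\<Sum>i<N. \<Sum>j<N. cnj (c i) * complex_of_real (x ^ (i + j)) * c j)" for x
  proof -
    have "complex_of_real ((cmod (coeff_poly c x))\<^sup>2) = cnj (coeff_poly c x) * coeff_poly c x"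
      by (simp only: complex_norm_square mult.commute)
    also have "\<dots> = (\<Sum>i<N. \<Sum>j<N.
        (cnj (c i) * complex_of_real x ^ i) * (c j * complex_of_real x ^ j))"
      by (simp add: coeff_poly_eq_sum[OF N] sum_product)
    finally show ?thesis
      by (simp add: power_add ac_simps)
  qed
  moreover have "has_bochner_integral \<mu>
      (\<lambda>x. \<Sum>i<N. \<Sum>j<N. cnj (c i) * complex_of_real (x ^ (i + j)) * c j)
      (matrix_form (moment_matrix \<mu>) c)"
    unfolding form moment_matrix_def
    by (intro has_bochner_integral_sum has_bochner_integral_mult_left
        has_bochner_integral_mult_right moment)
  ultimately show ?thesis by presburger
qed

text \<open>The complex form is the integral of a nonnegative real function, so \<open>cmod\<close>
  recovers that integral exactly. The version with values in \<open>ennreal\<close> is the one to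
  which Fatou's lemma applies.\<close>

lemma
  assumes "has_all_moments \<mu>" and "c \<in> fin_seqs"
  shows coeff_poly_square_integrable: "integrable \<mu> (\<lambda>x. (cmod (coeff_poly c x))\<^sup>2)"
    and nn_integral_coeff_poly:
      "(\<integral>\<^sup>+ x. ennreal ((cmod (coeff_poly c x))\<^sup>2) \<partial>\<mu>) =
         ennreal (cmod (matrix_form (moment_matrix \<mu>) c))"
proof -
  let ?f = "\<lambda>x. (cmod (coeff_poly c x))\<^sup>2"
  note h = moment_form_has_integral[OF assms]
  show int: "integrable \<mu> ?f"
    using integrable_Re[OF integrable.intros[OF h]] by simp
  have "matrix_form (moment_matrix \<mu>) c = complex_of_real (integral\<^sup>L \<mu> ?f)"
    using has_bochner_integral_integral_eq[OF h] by (simp only: integral_complex_of_real)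
  then have "cmod (matrix_form (moment_matrix \<mu>) c) = integral\<^sup>L \<mu> ?f"
    by (simp add: integral_nonneg_AE)
  then show "(\<integral>\<^sup>+ x. ennreal (?f x) \<partial>\<mu>) = ennreal (cmod (matrix_form (moment_matrix \<mu>) c))"
    using nn_integral_eq_integral[OF int] by simp
qed

text \<open>Evaluation at \<open>x\<close> is a bounded functional for the weighted norm because the
  sum of \<open>x ^ (2 * i) / w i\<close> converges; with factorial weights this sum is
  \<open>exp (x\<^sup>2)\<close>.\<close>

lemma coeff_poly_le_ell2_norm:
  assumes "c \<in> fin_seqs"
  shows "(cmod (coeff_poly c x))\<^sup>2 \<le> exp (x\<^sup>2) * (ell2_norm fact c)\<^sup>2"
proof -
  obtain N where N: "\<And>i. i \<ge> N \<Longrightarrow> c i = 0"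
    using fin_seqs_bounded_support[OF assms] by blast
  have "cmod (coeff_poly c x) = cmod (\<Sum>i<N. c i * complex_of_real x ^ i)"
    using coeff_poly_eq_sum[of N c] N by simp
  also have "\<dots> \<le> (\<Sum>i<N. cmod (c i) * \<bar>x\<bar> ^ i)"
    by (rule order_trans[OF norm_sum]) (simp add: norm_mult norm_power)
  \<comment> \<open>Inserting \<open>sqrt (fact i)\<close> and its reciprocal prepares
    Cauchy-Schwarz: the second factor yields the weighted norm, the first a partial sum of the
    exponential series at \<open>x\<^sup>2\<close>.\<close>
  also have "\<dots> = (\<Sum>i<N. (\<bar>x\<bar> ^ i / sqrt (fact i)) * (sqrt (fact i) * cmod (c i)))"
    by (intro sum.cong) auto
  finally have "(cmod (coeff_poly c x))\<^sup>2 \<le> \<dots>\<^sup>2" by (intro power_mono) auto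
  also have "\<dots> \<le> (\<Sum>i<N. (\<bar>x\<bar> ^ i / sqrt (fact i))\<^sup>2) * (\<Sum>i<N. (sqrt (fact i) * cmod (c i))\<^sup>2)"
    by (rule Cauchy_Schwarz_ineq_sum)
  also have "(\<Sum>i<N. (sqrt (fact i) * cmod (c i))\<^sup>2) = (ell2_norm fact c)\<^sup>2"
  proof -
    have "(\<Sum>i. fact i * (cmod (c i))\<^sup>2) = (\<Sum>i<N. fact i * (cmod (c i))\<^sup>2)"
      by (rule suminf_finite) (auto simp: N)
    then show ?thesis by (simp add: ell2_norm_def power_mult_distrib sum_nonneg)
  qed
  also have "(\<Sum>i<N. (\<bar>x\<bar> ^ i / sqrt (fact i))\<^sup>2) = (\<Sum>i<N. inverse (fact i) * (x\<^sup>2) ^ i)"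
  proof (intro sum.cong refl)
    fix i
    have "(\<bar>x\<bar> ^ i)\<^sup>2 = (x\<^sup>2) ^ i" by (metis power2_abs power_mult mult.commute)
    then show "(\<bar>x\<bar> ^ i / sqrt (fact i))\<^sup>2 = inverse (fact i) * (x\<^sup>2) ^ i"
      by (simp add: power_divide divide_inverse_commute[of _ "fact i"])
  qed
  \<comment> \<open>All terms are nonnegative, so passing to the full series removes the dependence
    on the cut-off \<open>N\<close>, which varies with \<open>c\<close>.\<close>
  also have "\<dots> \<le> (\<Sum>i. inverse (fact i) * (x\<^sup>2) ^ i)"
    by (intro sum_le_suminf summable_exp) auto
  also have "\<dots> = exp (x\<^sup>2)" by (simp add: exp_def)
  finally show ?thesis by (simp add: mult_right_mono)
qed

lemma coeff_poly_tendsto_0: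
  assumes "\<And>n. c n \<in> fin_seqs" and "(\<lambda>n. ell2_norm fact (c n)) \<longlonglongrightarrow> 0"
  shows "(\<lambda>n. coeff_poly (c n) x) \<longlonglongrightarrow> 0"
proof -
  have "(\<lambda>n. exp (x\<^sup>2) * (ell2_norm fact (c n))\<^sup>2) \<longlonglongrightarrow> exp (x\<^sup>2) * 0\<^sup>2"
    by (intro tendsto_intros assms(2))
  then have bound: "(\<lambda>n. exp (x\<^sup>2) * (ell2_norm fact (c n))\<^sup>2) \<longlonglongrightarrow> 0" by simp
  have "(\<lambda>n. (cmod (coeff_poly (c n) x))\<^sup>2) \<longlonglongrightarrow> 0"
    by (rule Lim_null_comparison[OF _ bound]) (simp add: coeff_poly_le_ell2_norm assms(1))
  then have "(\<lambda>n. sqrt ((cmod (coeff_poly (c n) x))\<^sup>2)) \<longlonglongrightarrow> sqrt 0"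
    by (intro tendsto_intros)
  then show ?thesis by (simp add: tendsto_norm_zero_iff)
qed

lemma moment_form_closable:
  assumes "has_all_moments \<mu>"
  shows "closable_in_ell2 fact (matrix_form (moment_matrix \<mu>))"
  unfolding closable_in_ell2_def
proof (intro allI impI)
  fix c :: "nat \<Rightarrow> nat \<Rightarrow> complex"
  let ?Q = "matrix_form (moment_matrix \<mu>)"
  assume "\<forall>n. c n \<in> fin_seqs"
  then have fin: "c n \<in> fin_seqs" for n by blast
  assume null: "(\<lambda>n. ell2_norm fact (c n)) \<longlonglongrightarrow> 0"
  assume cauchy: "((\<lambda>(m, n). ?Q (\<lambda>i. c n i - c m i)) \<longlongrightarrow> 0) (sequentially \<times>\<^sub>F sequentially)"
  show "(\<lambda>n. ?Q (c n)) \<longlonglongrightarrow> 0"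
  proof (rule metric_LIMSEQ_I)
    fix e :: real assume "e > 0"
    \<comment> \<open>The limit in \<open>m\<close> below only preserves a non-strict bound;
      starting from \<open>e / 2\<close> leaves room for the strict inequality at the end.\<close>
    then have "\<forall>\<^sub>F (m, n) in sequentially \<times>\<^sub>F sequentially. dist (?Q (\<lambda>i. c n i - c m i)) 0 < e / 2"
      using tendstoD[OF cauchy, of "e / 2"] by (simp add: case_prod_beta')
    then obtain N where N: "\<And>m n. m \<ge> N \<Longrightarrow> n \<ge> N \<Longrightarrow> cmod (?Q (\<lambda>i. c n i - c m i)) < e / 2"
      unfolding eventually_prod_sequentially by auto
    have "cmod (?Q (c n)) \<le> e / 2" if "n \<ge> N" for n
    proof -
      have diff: "(\<lambda>i. c n i - c m i) \<in> fin_seqs" for m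
        by (intro fin_seqs_diff fin)
      let ?g = "\<lambda>m x. ennreal ((cmod (coeff_poly (\<lambda>i. c n i - c m i) x))\<^sup>2)"
      \<comment> \<open>Here \<open>n\<close> stays fixed and \<open>m\<close> tends to infinity:
        the polynomial of \<open>c m\<close> vanishes pointwise in the limit, leaving that of
        \<open>c n\<close>.\<close>
      have "(\<lambda>m. ?g m x) \<longlonglongrightarrow> ennreal ((cmod (coeff_poly (c n) x - 0))\<^sup>2)" for x
        unfolding coeff_poly_diff[OF fin fin]
        by (intro tendsto_intros tendsto_ennrealI coeff_poly_tendsto_0 fin null)
      then have lim: "liminf (\<lambda>m. ?g m x) = ennreal ((cmod (coeff_poly (c n) x))\<^sup>2)" for x
        using lim_imp_Liminf[OF sequentially_bot] by fastforce
      have "ennreal (cmod (?Q (c n))) = (\<integral>\<^sup>+ x. liminf (\<lambda>m. ?g m x) \<partial>\<mu>)"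
        unfolding lim nn_integral_coeff_poly[OF assms fin] ..
      \<comment> \<open>Fatou's lemma; the side condition is measurability of each squared modulus,
        obtained from its integrability.\<close>
      also have "\<dots> \<le> liminf (\<lambda>m. \<integral>\<^sup>+ x. ?g m x \<partial>\<mu>)"
        using borel_measurable_integrable[OF coeff_poly_square_integrable[OF assms diff]]
        by (intro nn_integral_liminf measurable_compose[OF _ measurable_ennreal])
      also have "\<dots> = liminf (\<lambda>m. ennreal (cmod (?Q (\<lambda>i. c n i - c m i))))"
        unfolding nn_integral_coeff_poly[OF assms diff] ..
      \<comment> \<open>The limit superior inherits any bound valid for all large \<open>m\<close>,
        here the Cauchy estimate for \<open>m \<ge> N\<close>.\<close>
      also have "\<dots> \<le> limsup (\<lambda>m. ennreal (cmod (?Q (\<lambda>i. c n i - c m i))))"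
        by (rule Liminf_le_Limsup) simp
      also have "\<dots> \<le> ennreal (e / 2)"
        using N[OF _ that]
        by (intro Limsup_bounded eventually_sequentiallyI[of N] ennreal_leI less_imp_le)
      finally show ?thesis using \<open>e > 0\<close> by simp
    qed
    then show "\<exists>N. \<forall>n\<ge>N. dist (?Q (c n)) 0 < e"
      using \<open>e > 0\<close> by (intro exI[of _ N]) fastforce
  qed
qed

theorem theorem5p5:
  fixes \<mu> :: "real measure"
  assumes "sets \<mu> = sets borel"
    and "has_all_moments \<mu>"
  shows "\<exists>w. weights w \<and> closable_in_ell2 w (matrix_form (moment_matrix \<mu>))"
  \<comment> \<open>The witness is the factorial sequence, the same for every
    \<open>\<mu>\<close>.\<close>
  using moment_form_closable[OF assms(2)] by (intro exI[of _ fact]) (simp add: weights_def)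

end
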